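(* Let $n \geq 1$ and let $G$ be the hypertree $HT(n)$. Then the domination number of $G$ is $$\gamma(G) = \begin{cases} \frac{1}{7}(2^{n+2}+3) & \text{if } n\equiv 0 \pmod 3,\\ \frac{1}{7}(2^{n+2}-1) & \text{if } n\equiv 1 \pmod 3,\\ \frac{2}{7}(2^{n+1}-1) & \text{if } n\equiv 2 \pmod 3.\end{cases}$$
   Context: The hypertree $HT(n)$ has vertex set $\{1,2,\dots,2^{n+1}-1\}$. Its edges are the edges of the complete binary tree of height $n$ in which vertex $x$ has children $2x$ and $2x+1$ (the root is $1$, at level $0$; vertex $v$ lies at level $i$ iff $2^i \le v \le 2^{i+1}-1$), together with horizontal edges: for each level $i\ge 1$, two vertices at level $i$ are adjacent if their labels differ by $2^{i-1}$. A set $S\subseteq V(G)$ is dominating if every vertex of $V(G)\setminus S$ is adjacent to some vertex of $S$; $\gamma(G)$ is the minimum cardinality of a dominating set. *)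

theory Defs
  imports Complex_Main
begin

text \<open>A simple graph is given by its vertex set and its set of edges, an edge being the
  two-element set of its endpoints.\<close>

definition dominating_set :: "'a set \<Rightarrow> 'a set set \<Rightarrow> 'a set \<Rightarrow> bool" where
  "dominating_set V E S \<longleftrightarrow> S \<subseteq> V \<and> (\<forall>v \<in> V - S. \<exists>s \<in> S. {v, s} \<in> E)"

text \<open>Meaningful for finite \<open>V\<close> only.\<close>

definition domination_number :: "'a set \<Rightarrow> 'a set set \<Rightarrow> nat" where
  "domination_number V E = Min (card ` {S. dominating_set V E S})"

definition ht_verts :: "nat \<Rightarrow> nat set" where
  "ht_verts n = {1..2 ^ (n + 1) - 1}"

definition ht_level :: "nat \<Rightarrow> nat set" where
  "ht_level i = {2 ^ i..2 ^ (i + 1) - 1}"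

definition ht_tree_edges :: "nat \<Rightarrow> nat set set" where
  "ht_tree_edges n =
     {{x, y} | x y. x \<in> ht_verts n \<and> y \<in> ht_verts n \<and> (y = 2 * x \<or> y = 2 * x + 1)}"

definition ht_horizontal_edges :: "nat \<Rightarrow> nat set set" where
  "ht_horizontal_edges n =
     {{x, y} | x y i. x \<in> ht_verts n \<and> y \<in> ht_verts n \<and> i \<ge> 1 \<and>
        x \<in> ht_level i \<and> y \<in> ht_level i \<and> y = x + 2 ^ (i - 1)}"

definition ht_edges :: "nat \<Rightarrow> nat set set" where
  "ht_edges n = ht_tree_edges n \<union> ht_horizontal_edges n"

end

theory Submission
  imports Defs
begin

text \<open>
  Upper bound: all of level \<open>n + 2\<close> dominates levels \<open>n + 1\<close> to \<open>n + 3\<close>, so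
  \<open>\<gamma>(HT(n + 3)) \<le> \<gamma>(HT(n)) + 2 ^ (n + 2)\<close>.
  Lower bound: below a horizontal pair \<open>a < b\<close> of level \<open>n + 2\<close>, the leaves \<open>2 * a\<close> and
  \<open>2 * b + 1\<close> have disjoint closed neighbourhoods, all inside levels \<open>n + 2\<close> and \<open>n + 3\<close>. Hence
  a dominating set has at least \<open>2 ^ (n + 2)\<close> vertices there. Moving its vertices of level \<open>n + 1\<close>
  to their parents turns the remainder into a dominating set of \<open>HT(n)\<close>.
\<close>

text \<open>Free of n, so that one relation serves both \<open>HT(n)\<close> and
  \<open>HT(n + 3)\<close>; membership in \<open>ht_verts\<close> is tracked separately. Indexing
  levels by \<open>Suc i\<close> avoids the truncated subtraction in the exponent of the
  offset.\<close>

definition ht_adj :: "nat \<Rightarrow> nat \<Rightarrow> bool" where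
  "ht_adj x y \<longleftrightarrow> x = 2 * y \<or> x = 2 * y + 1 \<or> y = 2 * x \<or> y = 2 * x + 1 \<or>
     (\<exists>i. x \<in> ht_level (Suc i) \<and> y \<in> ht_level (Suc i) \<and> (x = y + 2 ^ i \<or> y = x + 2 ^ i))"

section \<open>Levels and adjacency in terms of inequalities\<close>

lemma ht_verts_iff: "x \<in> ht_verts n \<longleftrightarrow> 0 < x \<and> x < 2 * 2 ^ n"
proof -
  have "(0::nat) < 2 ^ n" by simp
  then have "x \<le> 2 * 2 ^ n - 1 \<longleftrightarrow> x < 2 * 2 ^ n" by linarith
  then show ?thesis by (simp add: ht_verts_def Suc_le_eq)
qed

lemma ht_level_iff: "x \<in> ht_level i \<longleftrightarrow> 2 ^ i \<le> x \<and> x < 2 * 2 ^ i"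
proof -
  have "(0::nat) < 2 ^ i" by simp
  then have "x \<le> 2 * 2 ^ i - 1 \<longleftrightarrow> x < 2 * 2 ^ i" by linarith
  then show ?thesis by (simp add: ht_level_def)
qed

lemma ht_edges_iff:
  "{x, y} \<in> ht_edges n \<longleftrightarrow> x \<in> ht_verts n \<and> y \<in> ht_verts n \<and> ht_adj x y"
proof -
  have "{x, y} \<in> ht_tree_edges n \<longleftrightarrow> x \<in> ht_verts n \<and> y \<in> ht_verts n \<and>
      (x = 2 * y \<or> x = 2 * y + 1 \<or> y = 2 * x \<or> y = 2 * x + 1)"
    unfolding ht_tree_edges_def by (auto simp: doubleton_eq_iff)
  moreover have "{x, y} \<in> ht_horizontal_edges n \<longleftrightarrow> x \<in> ht_verts n \<and> y \<in> ht_verts n \<and>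
      (\<exists>i. x \<in> ht_level (Suc i) \<and> y \<in> ht_level (Suc i) \<and> (x = y + 2 ^ i \<or> y = x + 2 ^ i))"
    (is "?L \<longleftrightarrow> ?R")
  proof
    assume ?L
    then obtain a b i where ab: "{x, y} = {a, b}" "a \<in> ht_verts n" "b \<in> ht_verts n" "i \<ge> 1"
      "a \<in> ht_level i" "b \<in> ht_level i" "b = a + 2 ^ (i - 1)"
      unfolding ht_horizontal_edges_def by blast
    then obtain j where "i = Suc j" by (cases i) auto
    with ab show ?R by (auto simp: doubleton_eq_iff)
  next
    assume ?R
    then obtain i where i: "x \<in> ht_verts n" "y \<in> ht_verts n" "x \<in> ht_level (Suc i)"
      "y \<in> ht_level (Suc i)" "x = y + 2 ^ (Suc i - 1) \<or> y = x + 2 ^ (Suc i - 1)" by auto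
    have "1 \<le> Suc i" by simp
    with i show ?L unfolding ht_horizontal_edges_def
      by (smt (verit, best) insert_commute mem_Collect_eq)
  qed
  ultimately show ?thesis unfolding ht_edges_def ht_adj_def by blast
qed

lemma dominating_ht_iff:
  "dominating_set (ht_verts n) (ht_edges n) S \<longleftrightarrow>
     S \<subseteq> ht_verts n \<and> (\<forall>v \<in> ht_verts n. v \<in> S \<or> (\<exists>s \<in> S. ht_adj v s))"
  unfolding dominating_set_def ht_edges_iff by blast

lemma power2_level_unique:
  fixes x :: nat
  assumes "2 ^ i \<le> x" "x < 2 * 2 ^ i" "2 ^ j \<le> x" "x < 2 * 2 ^ j"
  shows "i = j"
proof -
  have "(2::nat) ^ i < 2 ^ Suc j" "(2::nat) ^ j < 2 ^ Suc i" using assms by auto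
  then have "i < Suc j" "j < Suc i" using power_less_imp_less_exp one_less_numeral_iff
    by (metis semiring_norm(76))+
  then show ?thesis by simp
qed

text \<open>The bound on s excludes the children of v, which are at least
  \<open>2 * 2 ^ (k + 1)\<close>. A number lies on only one level, so a horizontal edge at v has
  offset \<open>2 ^ k\<close>.\<close>

lemma ht_adj_level:
  assumes "ht_adj v s" "v \<in> ht_level (Suc k)" "s < 4 * 2 ^ k"
  shows "s = v div 2 \<or> s \<in> ht_level (Suc k) \<and> (s = v + 2 ^ k \<or> v = s + 2 ^ k)"
  using assms(1) unfolding ht_adj_def
proof (elim disjE exE conjE)
  fix i assume "v \<in> ht_level (Suc i)" "s \<in> ht_level (Suc i)" "v = s + 2 ^ i"
  then show ?thesis using assms(2) power2_level_unique[of "Suc i" v "Suc k"]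
    by (auto simp: ht_level_iff)
next
  fix i assume "v \<in> ht_level (Suc i)" "s \<in> ht_level (Suc i)" "s = v + 2 ^ i"
  then show ?thesis using assms(2) power2_level_unique[of "Suc i" v "Suc k"]
    by (auto simp: ht_level_iff)
qed (use assms in \<open>auto simp: ht_level_iff\<close>)

text \<open>Horizontal edges stay on one level, so only edges to children leave
  \<open>HT(n)\<close>. Since \<open>1 = 2 * 0 + 1\<close>, \<open>ht_adj 1 0\<close> holds; the
  assumption \<open>0 < s\<close> excludes this.\<close>

lemma ht_adj_verts:
  assumes "ht_adj v s" "v \<in> ht_verts n" "0 < s"
  shows "s \<in> ht_verts n \<or> s \<in> ht_level (Suc n) \<and> s div 2 = v"
proof -
  consider "v = 2 * s \<or> v = 2 * s + 1 \<or> s = 2 * v \<or> s = 2 * v + 1"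
    | i where "v \<in> ht_level (Suc i)" "s \<in> ht_level (Suc i)"
    using assms(1) unfolding ht_adj_def by blast
  then show ?thesis
  proof cases
    case 1
    then show ?thesis using assms by (auto simp: ht_level_iff ht_verts_iff)
  next
    case i: 2
    then have "(2::nat) ^ Suc i \<le> v" "v < 2 ^ Suc n"
      using assms(2) by (simp_all add: ht_level_iff ht_verts_iff)
    then have "(2::nat) ^ Suc i < 2 ^ Suc n" by (rule le_less_trans)
    then have "Suc i < Suc n" by (rule power_less_imp_less_exp[rotated]) simp
    then have "(2::nat) ^ Suc i \<le> 2 ^ n" by (intro power_increasing) auto
    then show ?thesis using i by (auto simp: ht_level_iff ht_verts_iff)
  qed
qed

section \<open>Lower bound\<close>

lemma finite_ht_level: "finite (ht_level n)" and card_ht_level: "card (ht_level n) = 2 ^ n"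
  by (simp_all add: ht_level_def)

lemma finite_ht_verts: "finite (ht_verts n)"
  by (simp add: ht_verts_def)

lemma card_last_two_levels_ge:
  assumes dom: "dominating_set (ht_verts (k + 2)) (ht_edges (k + 2)) S"
  shows "2 ^ (k + 1) \<le> card (S \<inter> (ht_level (k + 1) \<union> ht_level (k + 2)))"
proof -
  \<comment> \<open>Level k + 1 is the interval from 2q to 4q - 1 with horizontal offset q, and 3q
    separates its halves; on level k + 2 all these values double.\<close>
  define q where "q = (2::nat) ^ k"
  have q: "q > 0" "2 ^ k = q" by (simp_all add: q_def)
  let ?B = "S \<inter> (ht_level (k + 1) \<union> ht_level (k + 2))"
  \<comment> \<open>\<open>f\<close> sends the closed neighbourhood of the leaf selected below \<open>a\<close> to \<open>a\<close>.\<close>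
  define f where "f s = (if s < 4 * q then s
    else if even s then (if s div 2 < 3 * q then s div 2 else s div 2 - q)
    else (if s div 2 < 3 * q then s div 2 + q else s div 2))" for s
  have "ht_level (k + 1) \<subseteq> f ` ?B"
  proof
    fix a assume "a \<in> ht_level (k + 1)"
    then have a: "2 * q \<le> a" "a < 4 * q" by (auto simp: ht_level_iff q)
    \<comment> \<open>Left child in the left half, right child in the right half: horizontal
      partners on level k + 2 have equal parity, so the parity of a leaf tells in which half a lies,
      and \<open>f\<close> can recover a.\<close>
    define v where "v = (if a < 3 * q then 2 * a else 2 * a + 1)"
    have v: "v \<in> ht_level (Suc (Suc k))" "v \<in> ht_verts (k + 2)" "v div 2 = a"
      using a q by (auto simp: ht_level_iff ht_verts_iff q v_def)
    obtain s where s: "s \<in> S" "s = v \<or> ht_adj v s"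
      using dom v(2) unfolding dominating_ht_iff by blast
    have sv: "s \<in> ht_verts (k + 2)" using s dom unfolding dominating_ht_iff by blast
    then have "s < 8 * q" by (auto simp: ht_verts_iff q)
    \<comment> \<open>The leaf v has no children below 8q, which leaves its parent and its
      horizontal partner.\<close>
    then have "s = v \<or> s = a \<or> s = v + 2 * q \<or> v = s + 2 * q \<and> 4 * q \<le> s"
      using s(2) ht_adj_level[of v s "Suc k"] v by (auto simp: q ht_level_iff)
    then have "f s = a \<and> (s \<in> ht_level (k + 1) \<or> s \<in> ht_level (k + 2))"
    proof (elim disjE)
      assume "s = v"
      then show ?thesis using a by (auto simp: f_def v_def ht_level_iff q)
    next
      assume "s = a"
      then show ?thesis using a by (auto simp: f_def ht_level_iff q)
    next
      assume s': "s = v + 2 * q"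
      \<comment> \<open>For a in the right half, v is at least 6q + 1, and v + 2q would leave the
        level.\<close>
      have "a < 3 * q" using s' \<open>s < 8 * q\<close> a by (auto simp: v_def split: if_splits)
      then show ?thesis using s' a by (auto simp: f_def v_def ht_level_iff q)
    next
      assume s': "v = s + 2 * q \<and> 4 * q \<le> s"
      \<comment> \<open>For a in the left half, v is below 6q, and v - 2q would drop below
        4q.\<close>
      then have "3 * q \<le> a" "s = 2 * (a - q) + 1" using a by (auto simp: v_def split: if_splits)
      then show ?thesis using a by (auto simp: f_def ht_level_iff q)
    qed
    then show "a \<in> f ` ?B" using s(1) by blast
  qed
  then have "card (ht_level (k + 1)) \<le> card ?B"
    by (intro surj_card_le) (auto simp: finite_ht_level)
  then show ?thesis by (simp add: card_ht_level)
qed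

text \<open>The recursion removes three levels at a time; \<open>HT(0)\<close> is a base case
  because n = 3 reduces to it.\<close>

fun ht_gamma :: "nat \<Rightarrow> nat" where
  "ht_gamma 0 = 1"
| "ht_gamma (Suc 0) = 1"
| "ht_gamma (Suc (Suc 0)) = 2"
| "ht_gamma (Suc (Suc (Suc n))) = ht_gamma n + 2 ^ (n + 2)"

lemma dominating_ht_nonempty:
  assumes "dominating_set (ht_verts n) (ht_edges n) S"
  shows "1 \<le> card S"
proof -
  have "1 \<in> ht_verts n" using one_less_power[of "2::nat" "Suc n"] by (simp add: ht_verts_iff)
  then have "S \<noteq> {}" using assms unfolding dominating_ht_iff by blast
  moreover have "finite S" using assms finite_ht_verts finite_subset
    unfolding dominating_ht_iff by blast
  ultimately show ?thesis by (simp add: Suc_le_eq card_gt_0_iff)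
qed

lemma ht_gamma_le_card:
  assumes "dominating_set (ht_verts n) (ht_edges n) S"
  shows "ht_gamma n \<le> card S"
  using assms
proof (induction n arbitrary: S rule: ht_gamma.induct)
  case 1
  then show ?case using dominating_ht_nonempty by simp
next
  case 2
  then show ?case using dominating_ht_nonempty by simp
next
  case (3 S)
  then have "finite S" using finite_ht_verts finite_subset unfolding dominating_ht_iff by blast
  \<comment> \<open>The base case n = 2 is the two-level bound with k = 0, which already gives
    2.\<close>
  then have "card (S \<inter> (ht_level (0 + 1) \<union> ht_level (0 + 2))) \<le> card S"
    by (intro card_mono) auto
  moreover have "dominating_set (ht_verts (0 + 2)) (ht_edges (0 + 2)) S"
    using 3 by (simp add: numeral_2_eq_2)
  ultimately show ?case using card_last_two_levels_ge[of 0 S] by simp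
next
  case (4 n)
  have dom: "dominating_set (ht_verts (n + 1 + 2)) (ht_edges (n + 1 + 2)) S"
    using 4(2) by simp
  have S: "S \<subseteq> ht_verts (Suc (Suc (Suc n)))" using 4(2) unfolding dominating_ht_iff by blast
  then have fin: "finite S" using finite_ht_verts finite_subset by blast
  let ?B = "S \<inter> (ht_level (n + 2) \<union> ht_level (n + 3))"
  let ?A = "S \<inter> ht_verts n" and ?C = "S \<inter> ht_level (Suc n)"
  \<comment> \<open>A vertex of \<open>HT(n)\<close> dominated by a child in \<open>?C\<close>
    becomes a member of \<open>?T\<close> itself. Siblings may merge under halving, which only
    lowers the cardinality.\<close>
  let ?T = "?A \<union> (\<lambda>x. x div 2) ` ?C"
  have "dominating_set (ht_verts n) (ht_edges n) ?T"
    unfolding dominating_ht_iff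
  proof (intro conjI ballI)
    have "x div 2 \<in> ht_verts n" if "x \<in> ht_level (Suc n)" for x
    proof -
      have "(0::nat) < 2 ^ n" by simp
      then have "0 < x div 2 \<and> x div 2 < 2 * 2 ^ n"
        using that unfolding ht_level_iff power_Suc by linarith
      then show ?thesis by (simp add: ht_verts_iff)
    qed
    then show "?T \<subseteq> ht_verts n" by auto
    fix v assume v: "v \<in> ht_verts n"
    then have "v \<in> ht_verts (Suc (Suc (Suc n)))" by (auto simp: ht_verts_iff)
    then consider "v \<in> S" | s where "s \<in> S" "ht_adj v s"
      using 4(2) unfolding dominating_ht_iff by blast
    then show "v \<in> ?T \<or> (\<exists>s\<in>?T. ht_adj v s)"
    proof cases
      case 1
      then show ?thesis using v by blast
    next
      case 2
      then have "0 < s" using S by (auto simp: ht_verts_iff)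
      then show ?thesis using ht_adj_verts[OF 2(2) v] 2 by blast
    qed
  qed
  then have "ht_gamma n \<le> card ?T" by (rule 4(1))
  also have "\<dots> \<le> card ?A + card ((\<lambda>x. x div 2) ` ?C)" by (rule card_Un_le)
  also have "\<dots> \<le> card ?A + card ?C" using fin by (simp add: card_image_le)
  also have "\<dots> = card (?A \<union> ?C)"
    using fin by (subst card_Un_disjoint) (auto simp: ht_verts_iff ht_level_iff)
  finally have "ht_gamma n \<le> card (?A \<union> ?C)" .
  moreover have "2 ^ (n + 2) \<le> card ?B"
    using card_last_two_levels_ge[OF dom] by (simp add: numeral_3_eq_3)
  moreover have "card (?A \<union> ?C) + card ?B \<le> card S"
  proof -
    have "card (?A \<union> ?C) + card ?B = card (?A \<union> ?C \<union> ?B)"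
      using fin by (subst card_Un_disjoint[symmetric])
        (auto simp: ht_verts_iff ht_level_iff numeral_3_eq_3)
    also have "\<dots> \<le> card S" using fin by (intro card_mono) auto
    finally show ?thesis .
  qed
  ultimately show ?case by simp
qed

section \<open>Upper bound by explicit dominating sets\<close>

lemma dominating_ht_exists:
  "\<exists>S. dominating_set (ht_verts n) (ht_edges n) S \<and> card S = ht_gamma n"
proof (induction n rule: ht_gamma.induct)
  case 1
  have "dominating_set (ht_verts 0) (ht_edges 0) {1}"
    by (auto simp: dominating_ht_iff ht_verts_iff)
  then show ?case by (metis ht_gamma.simps(1) is_singletonI is_singleton_altdef)
next
  case 2
  have "v \<in> {1, 2, 3}" if "v \<in> ht_verts (Suc 0)" for v
    using that by (auto simp: ht_verts_iff)
  moreover have "ht_adj 2 1" "ht_adj 3 1" by (auto simp: ht_adj_def)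
  ultimately have "dominating_set (ht_verts (Suc 0)) (ht_edges (Suc 0)) {1}"
    by (fastforce simp: dominating_ht_iff ht_verts_iff)
  then show ?case by (metis ht_gamma.simps(2) is_singletonI is_singleton_altdef)
next
  case 3
  \<comment> \<open>All of level 1 is chosen: the root is its parent, and level 2 consists of its
    children.\<close>
  have "v = 2 \<or> v = 3 \<or> ht_adj v 2 \<or> ht_adj v 3" if "v \<in> ht_verts (Suc (Suc 0))" for v
  proof -
    have "v \<in> {1, 2, 3, 4, 5, 6, 7}" using that by (auto simp: ht_verts_iff)
    then show ?thesis by (auto simp: ht_adj_def)
  qed
  then have "dominating_set (ht_verts (Suc (Suc 0))) (ht_edges (Suc (Suc 0))) {2, 3}"
    by (auto simp: dominating_ht_iff ht_verts_iff)
  moreover have "card {2, 3::nat} = 2" by simp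
  ultimately show ?case by (metis ht_gamma.simps(3))
next
  case (4 n)
  then obtain D where D: "dominating_set (ht_verts n) (ht_edges n) D" "card D = ht_gamma n"
    by blast
  let ?L = "ht_level (n + 2)"
  have Dv: "D \<subseteq> ht_verts n" using D unfolding dominating_ht_iff by blast
  have "dominating_set (ht_verts (Suc (Suc (Suc n)))) (ht_edges (Suc (Suc (Suc n)))) (D \<union> ?L)"
    unfolding dominating_ht_iff
  proof (intro conjI ballI)
    show "D \<union> ?L \<subseteq> ht_verts (Suc (Suc (Suc n)))"
      using Dv by (auto simp: ht_verts_iff ht_level_iff)
    fix v assume "v \<in> ht_verts (Suc (Suc (Suc n)))"
    then consider "v \<in> ht_verts n" | "v \<in> ht_level (n + 1)" | "v \<in> ?L" | "v \<in> ht_level (n + 3)"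
      by (fastforce simp: ht_verts_iff ht_level_iff numeral_3_eq_3)
    then show "v \<in> D \<union> ?L \<or> (\<exists>s\<in>D \<union> ?L. ht_adj v s)"
    proof cases
      case 1
      then show ?thesis using D unfolding dominating_ht_iff by blast
    next
      case 2
      \<comment> \<open>Level n + 1 is dominated from its children; level n + 3, below, from its
        parents.\<close>
      then have "2 * v \<in> ?L" by (auto simp: ht_level_iff)
      moreover have "ht_adj v (2 * v)" by (simp add: ht_adj_def)
      ultimately show ?thesis by blast
    next
      case 3
      then show ?thesis by blast
    next
      case 4
      then have "v div 2 \<in> ?L" by (auto simp: ht_level_iff numeral_3_eq_3)
      moreover have "ht_adj v (v div 2)" unfolding ht_adj_def by linarith
      ultimately show ?thesis by blast
    qed
  qed
  moreover have "card (D \<union> ?L) = ht_gamma n + 2 ^ (n + 2)"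
  proof -
    have "finite D" using Dv finite_ht_verts finite_subset by blast
    moreover have "D \<inter> ?L = {}" using Dv by (fastforce simp: ht_verts_iff ht_level_iff)
    ultimately show ?thesis using D(2) by (simp add: card_Un_disjoint finite_ht_level card_ht_level)
  qed
  ultimately show ?case by auto
qed

section \<open>The minimum and its closed form\<close>

lemma domination_number_ht: "domination_number (ht_verts n) (ht_edges n) = ht_gamma n"
  unfolding domination_number_def
proof (rule Min_eqI)
  \<comment> \<open>\<open>Min\<close> is meaningful only on a finite set; the power set of the
    vertices supplies the bound.\<close>
  have "{S. dominating_set (ht_verts n) (ht_edges n) S} \<subseteq> Pow (ht_verts n)"
    by (auto simp: dominating_set_def)
  then show "finite (card ` {S. dominating_set (ht_verts n) (ht_edges n) S})"
    by (meson finite_Pow_iff finite_imageI finite_ht_verts finite_subset)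
qed (use ht_gamma_le_card in auto, use dominating_ht_exists in force)

text \<open>From n to n + 3 each branch grows by
  \<open>(2 ^ (n + 5) - 2 ^ (n + 2)) / 7 = 2 ^ (n + 2)\<close>, the increment in the recursion,
  while the residue modulo 3 is unchanged.\<close>

lemma ht_gamma_closed_form:
  "real (ht_gamma n) =
    (if n mod 3 = 0 then 1 / 7 * (2 ^ (n + 2) + 3)
     else if n mod 3 = 1 then 1 / 7 * (2 ^ (n + 2) - 1)
     else 2 / 7 * (2 ^ (n + 1) - 1))"
proof (induction n rule: ht_gamma.induct)
  case (4 n)
  have "Suc (Suc (Suc n)) mod 3 = n mod 3" by presburger
  then show ?case using 4 by (simp add: field_simps)
qed auto

theorem theorem1:
  fixes n :: nat
  assumes "n \<ge> 1"
  shows "real (domination_number (ht_verts n) (ht_edges n)) =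
    (if n mod 3 = 0 then 1 / 7 * (2 ^ (n + 2) + 3)
     else if n mod 3 = 1 then 1 / 7 * (2 ^ (n + 2) - 1)
     else 2 / 7 * (2 ^ (n + 1) - 1))"
  unfolding domination_number_ht by (rule ht_gamma_closed_form)

end
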